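(* Let $a,d\in\mathbb{N}$. The circles of partition $\mathcal{C}(n,\mathbb{M}_{a,d})$ with $n\in\mathbb{M}_{2a,d}$ admit aligned embedding. That is, for all $n,m\in\mathbb{M}_{2a,d}$ generating two distinct circles of partition, one has $\mathcal{C}(n,\mathbb{M}_{a,d})\subset\mathcal{C}(m,\mathbb{M}_{a,d})$ (proper inclusion) if and only if $n<m$, and $\mathcal{C}(n,\mathbb{M}_{a,d})\supset\mathcal{C}(m,\mathbb{M}_{a,d})$ (proper inclusion) if and only if $n>m$; moreover, for all $n,m\in\mathbb{M}_{2a,d}$, $\mathcal{C}(n,\mathbb{M}_{a,d})=\mathcal{C}(m,\mathbb{M}_{a,d})$ if and only if $n=m$.
   Context: $\mathbb{N}$ is the set of positive integers. For $a,d\in\mathbb{N}$, $\mathbb{M}_{a,d}=\{x\in\mathbb{N}: x\equiv a \pmod d\}$. For $\mathbb{M}\subseteq\mathbb{N}$ and $n\in\mathbb{N}$, the circle of partition (CoP) is $\mathcal{C}(n,\mathbb{M})=\{[x]: x,y\in\mathbb{M},\ x+y=n\}$. Points $[x]$ are formal symbols identified by their weight $x$. Distinct CoPs $\mathcal{C}(n,\mathbb{M})$, $\mathcal{C}(m,\mathbb{M})$ admit aligned embedding if and only if $\mathcal{C}(n,\mathbb{M})\subset\mathcal{C}(m,\mathbb{M})$ holds with $n<m$, $\mathcal{C}(n,\mathbb{M})\supset\mathcal{C}(m,\mathbb{M})$ holds with $n>m$, and $\mathcal{C}(n,\mathbb{M})=\mathcal{C}(m,\mathbb{M})$ holds if and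 only if $n=m$. *)

theory Defs
  imports Main "HOL-Number_Theory.Cong"
begin

definition arith_class :: "nat \<Rightarrow> nat \<Rightarrow> nat set" where
  "arith_class a d = {x. x \<ge> 1 \<and> [x = a] (mod d)}"

text \<open>A point \<open>[x]\<close> is a formal symbol, identified by its weight \<open>x\<close>.\<close>

datatype cop_point = Pt (weight: nat)

text \<open>
  The circle of partition \<open>C(n, M)\<close>. The base set \<open>M\<close> is meant to consist of positive
  integers; the definition does not enforce this. A circle may be empty.
\<close>

definition cop :: "nat \<Rightarrow> nat set \<Rightarrow> cop_point set" where
  "cop n M = {Pt x | x y. x \<in> M \<and> y \<in> M \<and> x + y = n}"

text \<open>
  The circles \<open>C(n, M)\<close> with generators \<open>n\<close> in \<open>I\<close> admit aligned embedding. Distinctness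
  in the first conjunct is that of the circles as sets; by the second conjunct, it amounts to
  distinctness of the generators.
\<close>

definition admit_aligned_embedding :: "nat set \<Rightarrow> nat set \<Rightarrow> bool" where
  "admit_aligned_embedding I M \<longleftrightarrow>
     (\<forall>n\<in>I. \<forall>m\<in>I. cop n M \<noteq> cop m M \<longrightarrow>
        (cop n M \<subset> cop m M \<longleftrightarrow> n < m) \<and>
        (cop n M \<supset> cop m M \<longleftrightarrow> n > m)) \<and>
     (\<forall>n\<in>I. \<forall>m\<in>I. cop n M = cop m M \<longleftrightarrow> n = m)"

end

theory Submission
  imports Defs
begin

text \<open>
  Write \<open>M\<close> for the class of \<open>a\<close> modulo \<open>d\<close>. If \<open>n\<close> is congruent to \<open>2 * a\<close>, the partner
  \<open>n - x\<close> of any \<open>x \<in> M\<close> with \<open>x < n\<close> is automatically in \<open>M\<close>. The circle generated by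
  \<open>n\<close> is therefore nothing but the initial segment of \<open>M\<close> below \<open>n\<close>
  (\<open>cop_arith_class_eq\<close>), and such segments grow with \<open>n\<close>. The growth is strict: two
  different generators are congruent modulo \<open>d\<close>, so they are at least \<open>d\<close> apart, and any \<open>d\<close>
  consecutive positive integers contain an element of \<open>M\<close>, which separates the two segments
  (\<open>arith_class_between\<close>). A strictly increasing map from a linear order into sets ordered
  by inclusion reflects the order, which gives all the equivalences of aligned embedding.
\<close>

lemma diff_mem_arith_class:
  assumes n: "n \<in> arith_class (2 * a) d" and x: "x \<in> arith_class a d" and "x < n"
  shows "n - x \<in> arith_class a d"
proof -
  have "[x + (n - x) = a + a] (mod d)"
    using n \<open>x < n\<close> by (simp add: arith_class_def mult_2)
  moreover have "[a + (n - x) = x + (n - x)] (mod d)"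
    using x by (intro cong_add cong_refl) (simp add: arith_class_def cong_sym)
  ultimately have "[a + (n - x) = a + a] (mod d)"
    by (rule cong_trans[rotated])
  then have "[n - x = a] (mod d)"
    by (simp add: cong_add_lcancel_nat)
  then show ?thesis
    using \<open>x < n\<close> by (simp add: arith_class_def)
qed

lemma cop_arith_class_eq:
  assumes "n \<in> arith_class (2 * a) d"
  shows "cop n (arith_class a d) = Pt ` {x \<in> arith_class a d. x < n}"
proof (intro set_eqI iffI)
  fix p assume "p \<in> cop n (arith_class a d)"
  then obtain x y where "p = Pt x" "x \<in> arith_class a d" "y \<in> arith_class a d" "x + y = n"
    by (auto simp: cop_def)
  moreover from this have "x < n"
    by (auto simp: arith_class_def)
  ultimately show "p \<in> Pt ` {x \<in> arith_class a d. x < n}"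
    by blast
next
  fix p assume "p \<in> Pt ` {x \<in> arith_class a d. x < n}"
  then obtain x where x: "p = Pt x" "x \<in> arith_class a d" "x < n"
    by blast
  then have "x + (n - x) = n"
    by simp
  with x diff_mem_arith_class[OF assms x(2,3)] show "p \<in> cop n (arith_class a d)"
    unfolding cop_def by blast
qed

lemma arith_class_between:
  assumes "d \<ge> 1" and n: "n \<in> arith_class (2 * a) d" and m: "m \<in> arith_class (2 * a) d"
    and "n < m"
  obtains x where "x \<in> arith_class a d" "n \<le> x" "x < m"
proof
  \<comment> \<open>Since \<open>n\<close> is congruent to \<open>2 * a\<close>, the distance from \<open>n\<close> up to the next element of
    the class of \<open>a\<close> is the residue of \<open>- a\<close>, written as \<open>(d - 1) * a\<close> to stay within the
    natural numbers.\<close>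
  let ?x = "n + ((d - 1) * a) mod d"
  have "[?x = 2 * a + (d - 1) * a] (mod d)"
    using n by (intro cong_add) (simp_all add: arith_class_def)
  also have "2 * a + (d - 1) * a = a + a * d"
    using \<open>d \<ge> 1\<close> by (cases d) (simp_all add: algebra_simps)
  also have "[a + a * d = a] (mod d)"
    by (simp add: cong_def)
  finally show "?x \<in> arith_class a d"
    using n by (simp add: arith_class_def)
  show "n \<le> ?x"
    by simp
  have "[m = n] (mod d)"
    using n m by (auto simp: arith_class_def cong_def)
  then have "d dvd m - n"
    using \<open>n < m\<close> by (simp add: cong_altdef_nat)
  then have "d \<le> m - n"
    using \<open>n < m\<close> by (intro dvd_imp_le) simp_all
  moreover have "((d - 1) * a) mod d < d"
    using \<open>d \<ge> 1\<close> by simp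
  ultimately show "?x < m"
    by linarith
qed

lemma cop_arith_class_strict_mono:
  assumes "d \<ge> 1" and n: "n \<in> arith_class (2 * a) d" and m: "m \<in> arith_class (2 * a) d"
    and "n < m"
  shows "cop n (arith_class a d) \<subset> cop m (arith_class a d)"
proof -
  obtain x where x: "x \<in> arith_class a d" "n \<le> x" "x < m"
    using arith_class_between[OF assms] .
  have "cop n (arith_class a d) \<subseteq> cop m (arith_class a d)"
    using \<open>n < m\<close> by (auto simp: cop_arith_class_eq[OF n] cop_arith_class_eq[OF m])
  moreover have "Pt x \<in> cop m (arith_class a d)" "Pt x \<notin> cop n (arith_class a d)"
    using x by (auto simp: cop_arith_class_eq[OF n] cop_arith_class_eq[OF m])
  ultimately show ?thesis
    by blast
qed

theorem theorem2p10:
  fixes a d :: nat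
  assumes "a \<ge> 1" and "d \<ge> 1"
  shows "admit_aligned_embedding (arith_class (2 * a) d) (arith_class a d)"
proof -
  let ?C = "\<lambda>n. cop n (arith_class a d)"
  have "(?C n \<subset> ?C m \<longleftrightarrow> n < m) \<and> (?C n \<supset> ?C m \<longleftrightarrow> n > m) \<and> (?C n = ?C m \<longleftrightarrow> n = m)"
    if n: "n \<in> arith_class (2 * a) d" and m: "m \<in> arith_class (2 * a) d" for n m
    using cop_arith_class_strict_mono[OF \<open>d \<ge> 1\<close> n m] cop_arith_class_strict_mono[OF \<open>d \<ge> 1\<close> m n]
    by (cases n m rule: linorder_cases) auto
  then show ?thesis
    unfolding admit_aligned_embedding_def by blast
qed

end
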